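(* Let $\mathcal{C}$ be a category with finite products and finite coproducts, and let $E$ be an object of $\mathcal{C}$ (the object of exceptions). Assume $\mathcal{C}$ is extensive with respect to $E$: for every morphism $f\colon A\to B+E$, the pullbacks of the coprojections $\mathrm{copr}_1\colon B\to B+E$ and $\mathrm{copr}_2\colon E\to B+E$ along $f$ exist, say $i_f\colon \mathcal{D}_f\to A$ with $f_{\mathrm{normal}}\colon\mathcal{D}_f\to B$ (so $f\circ i_f=\mathrm{copr}_1\circ f_{\mathrm{normal}}$) and $j_f\colon\mathcal{E}_f\to A$ with $f_{\mathrm{abrupt}}\colon\mathcal{E}_f\to E$, and $i_f,j_f$ exhibit $A$ as a coproduct $A\cong\mathcal{D}_f+\mathcal{E}_f$. Consider the programmer's language for exceptions whose pure terms $A\to B$ are morphisms $A\to B$ of $\mathcal{C}$ and whose general terms (propagators) $A\to B$ are morphisms $A\to B+E$ of $\mathcal{C}$, as described in the context. Then this language is compatible with conditionals and with sequential pairs with respect to the relation $\gg$ defined by: for a pure term $v\colon A\to B$ and a propagator $f\colon A\to B$, $v\gg f$ iff $v\circ i_f=f_{\mathrm{normal}}\colon\mathcal{D}_f\to B$. Explicitly: (1) for all propagators $f_1\colon A_1\to B$, $f_2\colon A_2\to B$ there is a unique propagator $h\colon A_1+A_2\to B$ with $h\circ\mathrm{copr}_1=f_1$ and $h\circ\mathrm{copr}_2=f_2$; (2) for every pure $f_1\colon A\to B_1$ and propagator $f_2\colon A\to B_2$ there is a unique propagator $\langle f_1,f_2\rangle_l\colon A\to B_1\times B_2$ with $f_1\gg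 \mathrm{pr}_1\circ\langle f_1,f_2\rangle_l$ and $\mathrm{pr}_2\circ\langle f_1,f_2\rangle_l=f_2$, and symmetrically for every propagator $f_1\colon A\to B_1$ and pure $f_2\colon A\to B_2$ there is a unique propagator $\langle f_1,f_2\rangle_r\colon A\to B_1\times B_2$ with $\mathrm{pr}_1\circ\langle f_1,f_2\rangle_r=f_1$ and $f_2\gg\mathrm{pr}_2\circ\langle f_1,f_2\rangle_r$ (compositions and equalities taken among propagators).
   Context: The monad of exceptions on $\mathcal{C}$ has endofunctor $X\mapsto X+E$, unit $\eta_X\colon X\to X+E$ the coprojection, and multiplication $\mu_X=[\mathrm{id}_{X+E}\mid \mathrm{copr}_X]\colon (X+E)+E\to X+E$. In the programmer's language for exceptions, a pure term $v\colon A\to B$ is a morphism $v\colon A\to B$ of $\mathcal{C}$, regarded as the propagator $\eta_B\circ v$; a propagator (general term) $f\colon A\to B$ is a morphism $f\colon A\to B+E$ of $\mathcal{C}$; propagators compose in the Kleisli way: $g\circ f=\mu_C\circ(g+\mathrm{id}_E)\circ f$ for $f\colon A\to B+E$, $g\colon B\to C+E$; equality of propagators is equality of the morphisms into $B+E$. Projections and coprojections are pure. A language with effects (pure terms forming a category $\mathcal{C}$ with finite products and coproducts, general terms forming a larger category with the same objects) is compatible with conditionals if copairs of general terms exist uniquely as in (1), and compatible with sequential pairs with respect to a relation $\gg$ between pure and general terms (which is equality when both are pure) if left and right pairs of a pure term and a general term exist uniquely as in (2). *)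

theory Defs
  imports Main
begin

section \<open>Categories, finite products and finite coproducts\<close>

text \<open>
  A category is given by a family of hom-sets, which are not required to be disjoint; composition
  is therefore indexed by objects: \<open>Comp C X Y Z g f\<close> is \<open>g \<circ> f : X \<rightarrow> Z\<close> for \<open>f : X \<rightarrow> Y\<close> and
  \<open>g : Y \<rightarrow> Z\<close>. This lets a Kleisli category, where a morphism \<open>f : A \<rightarrow> B + E\<close> of the base need
  not determine \<open>B\<close>, be an instance of the same structure.
\<close>

record ('o, 'm) category =
  Obj :: "'o set"
  Hom :: "'o \<Rightarrow> 'o \<Rightarrow> 'm set"
  Ident :: "'o \<Rightarrow> 'm"
  Comp :: "'o \<Rightarrow> 'o \<Rightarrow> 'o \<Rightarrow> 'm \<Rightarrow> 'm \<Rightarrow> 'm"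

definition is_category :: "('o, 'm, 'z) category_scheme \<Rightarrow> bool" where
  "is_category C \<longleftrightarrow>
     (\<forall>A\<in>Obj C. Ident C A \<in> Hom C A A) \<and>
     (\<forall>A\<in>Obj C. \<forall>B\<in>Obj C. \<forall>D\<in>Obj C. \<forall>f\<in>Hom C A B. \<forall>g\<in>Hom C B D.
        Comp C A B D g f \<in> Hom C A D) \<and>
     (\<forall>A\<in>Obj C. \<forall>B\<in>Obj C. \<forall>f\<in>Hom C A B.
        Comp C A A B f (Ident C A) = f \<and> Comp C A B B (Ident C B) f = f) \<and>
     (\<forall>A\<in>Obj C. \<forall>B\<in>Obj C. \<forall>D\<in>Obj C. \<forall>F\<in>Obj C.
        \<forall>f\<in>Hom C A B. \<forall>g\<in>Hom C B D. \<forall>h\<in>Hom C D F.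
        Comp C A B F (Comp C B D F h g) f = Comp C A D F h (Comp C A B D g f))"

definition is_terminal :: "('o, 'm, 'z) category_scheme \<Rightarrow> 'o \<Rightarrow> bool" where
  "is_terminal C T \<longleftrightarrow> T \<in> Obj C \<and> (\<forall>X\<in>Obj C. \<exists>!h. h \<in> Hom C X T)"

definition is_initial :: "('o, 'm, 'z) category_scheme \<Rightarrow> 'o \<Rightarrow> bool" where
  "is_initial C I \<longleftrightarrow> I \<in> Obj C \<and> (\<forall>X\<in>Obj C. \<exists>!h. h \<in> Hom C I X)"

definition is_product ::
    "('o, 'm, 'z) category_scheme \<Rightarrow> 'o \<Rightarrow> 'o \<Rightarrow> 'o \<Rightarrow> 'm \<Rightarrow> 'm \<Rightarrow> bool" where
  "is_product C A B P p q \<longleftrightarrow>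
     P \<in> Obj C \<and> p \<in> Hom C P A \<and> q \<in> Hom C P B \<and>
     (\<forall>X\<in>Obj C. \<forall>f\<in>Hom C X A. \<forall>g\<in>Hom C X B.
        \<exists>!h. h \<in> Hom C X P \<and> Comp C X P A p h = f \<and> Comp C X P B q h = g)"

definition is_coproduct ::
    "('o, 'm, 'z) category_scheme \<Rightarrow> 'o \<Rightarrow> 'o \<Rightarrow> 'o \<Rightarrow> 'm \<Rightarrow> 'm \<Rightarrow> bool" where
  "is_coproduct C A B S i j \<longleftrightarrow>
     S \<in> Obj C \<and> i \<in> Hom C A S \<and> j \<in> Hom C B S \<and>
     (\<forall>X\<in>Obj C. \<forall>f\<in>Hom C A X. \<forall>g\<in>Hom C B X.
        \<exists>!h. h \<in> Hom C S X \<and> Comp C A S X h i = f \<and> Comp C B S X h j = g)"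

text \<open>
  \<open>is_pullback C A B Z f g P p q\<close>: the morphisms \<open>p : P \<rightarrow> A\<close> and \<open>q : P \<rightarrow> B\<close> form a pullback
  of \<open>f : A \<rightarrow> Z\<close> and \<open>g : B \<rightarrow> Z\<close>.
\<close>

definition is_pullback ::
    "('o, 'm, 'z) category_scheme \<Rightarrow> 'o \<Rightarrow> 'o \<Rightarrow> 'o \<Rightarrow> 'm \<Rightarrow> 'm \<Rightarrow> 'o \<Rightarrow> 'm \<Rightarrow> 'm \<Rightarrow> bool" where
  "is_pullback C A B Z f g P p q \<longleftrightarrow>
     P \<in> Obj C \<and> p \<in> Hom C P A \<and> q \<in> Hom C P B \<and>
     Comp C P A Z f p = Comp C P B Z g q \<and>
     (\<forall>X\<in>Obj C. \<forall>a\<in>Hom C X A. \<forall>b\<in>Hom C X B. Comp C X A Z f a = Comp C X B Z g b \<longrightarrow>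
        (\<exists>!h. h \<in> Hom C X P \<and> Comp C X P A p h = a \<and> Comp C X P B q h = b))"

record ('o, 'm) bicartesian = "('o, 'm) category" +
  Terminal :: "'o"
  Prod :: "'o \<Rightarrow> 'o \<Rightarrow> 'o"
  Pr1 :: "'o \<Rightarrow> 'o \<Rightarrow> 'm"
  Pr2 :: "'o \<Rightarrow> 'o \<Rightarrow> 'm"
  Initial :: "'o"
  Coprod :: "'o \<Rightarrow> 'o \<Rightarrow> 'o"
  Copr1 :: "'o \<Rightarrow> 'o \<Rightarrow> 'm"
  Copr2 :: "'o \<Rightarrow> 'o \<Rightarrow> 'm"

definition is_bicartesian :: "('o, 'm, 'z) bicartesian_scheme \<Rightarrow> bool" where
  "is_bicartesian C \<longleftrightarrow>
     is_category C \<and>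
     is_terminal C (Terminal C) \<and>
     (\<forall>A\<in>Obj C. \<forall>B\<in>Obj C. is_product C A B (Prod C A B) (Pr1 C A B) (Pr2 C A B)) \<and>
     is_initial C (Initial C) \<and>
     (\<forall>A\<in>Obj C. \<forall>B\<in>Obj C. is_coproduct C A B (Coprod C A B) (Copr1 C A B) (Copr2 C A B))"

definition copair ::
    "('o, 'm, 'z) bicartesian_scheme \<Rightarrow> 'o \<Rightarrow> 'o \<Rightarrow> 'o \<Rightarrow> 'm \<Rightarrow> 'm \<Rightarrow> 'm" where
  "copair C A B X f g =
     (THE h. h \<in> Hom C (Coprod C A B) X \<and>
        Comp C A (Coprod C A B) X h (Copr1 C A B) = f \<and>
        Comp C B (Coprod C A B) X h (Copr2 C A B) = g)"

text \<open>\<open>coprod_map C A A' B B' f g\<close> is \<open>f + g : A + B \<rightarrow> A' + B'\<close> for \<open>f : A \<rightarrow> A'\<close>, \<open>g : B \<rightarrow> B'\<close>.\<close>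

definition coprod_map ::
    "('o, 'm, 'z) bicartesian_scheme \<Rightarrow> 'o \<Rightarrow> 'o \<Rightarrow> 'o \<Rightarrow> 'o \<Rightarrow> 'm \<Rightarrow> 'm \<Rightarrow> 'm" where
  "coprod_map C A A' B B' f g =
     copair C A B (Coprod C A' B')
       (Comp C A A' (Coprod C A' B') (Copr1 C A' B') f)
       (Comp C B B' (Coprod C A' B') (Copr2 C A' B') g)"


section \<open>Languages with effects\<close>

text \<open>
  \<open>C\<close> is the category of pure terms, \<open>K\<close> the category of general terms, and \<open>J A B\<close> regards a pure
  term \<open>A \<rightarrow> B\<close> as a general term \<open>A \<rightarrow> B\<close>. That \<open>K\<close> is larger than \<open>C\<close> means that \<open>J\<close> is an
  identity-on-objects functor that is injective on each hom-set.
\<close>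

definition language_with_effects ::
    "('o, 'm, 'z) bicartesian_scheme \<Rightarrow> ('o, 'k, 'y) category_scheme \<Rightarrow>
     ('o \<Rightarrow> 'o \<Rightarrow> 'm \<Rightarrow> 'k) \<Rightarrow> bool" where
  "language_with_effects C K J \<longleftrightarrow>
     is_bicartesian C \<and> is_category K \<and> Obj K = Obj C \<and>
     (\<forall>A\<in>Obj C. \<forall>B\<in>Obj C. J A B ` Hom C A B \<subseteq> Hom K A B \<and> inj_on (J A B) (Hom C A B)) \<and>
     (\<forall>A\<in>Obj C. J A A (Ident C A) = Ident K A) \<and>
     (\<forall>A\<in>Obj C. \<forall>B\<in>Obj C. \<forall>D\<in>Obj C. \<forall>v\<in>Hom C A B. \<forall>w\<in>Hom C B D.
        J A D (Comp C A B D w v) = Comp K A B D (J B D w) (J A B v))"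

definition compatible_with_conditionals ::
    "('o, 'm, 'z) bicartesian_scheme \<Rightarrow> ('o, 'k, 'y) category_scheme \<Rightarrow>
     ('o \<Rightarrow> 'o \<Rightarrow> 'm \<Rightarrow> 'k) \<Rightarrow> bool" where
  "compatible_with_conditionals C K J \<longleftrightarrow>
     (\<forall>A1\<in>Obj C. \<forall>A2\<in>Obj C. \<forall>B\<in>Obj C. \<forall>f1\<in>Hom K A1 B. \<forall>f2\<in>Hom K A2 B.
        \<exists>!h. h \<in> Hom K (Coprod C A1 A2) B \<and>
          Comp K A1 (Coprod C A1 A2) B h (J A1 (Coprod C A1 A2) (Copr1 C A1 A2)) = f1 \<and>
          Comp K A2 (Coprod C A1 A2) B h (J A2 (Coprod C A1 A2) (Copr2 C A1 A2)) = f2)"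

text \<open>
  \<open>R A B v f\<close> is a relation between pure terms \<open>v : A \<rightarrow> B\<close> and general terms \<open>f : A \<rightarrow> B\<close>. The
  first conjunct says that it is equality when both terms are pure; the other two are the unique
  existence of left pairs (pure term first) and of right pairs (pure term second).
\<close>

definition compatible_with_sequential_pairs ::
    "('o, 'm, 'z) bicartesian_scheme \<Rightarrow> ('o, 'k, 'y) category_scheme \<Rightarrow>
     ('o \<Rightarrow> 'o \<Rightarrow> 'm \<Rightarrow> 'k) \<Rightarrow> ('o \<Rightarrow> 'o \<Rightarrow> 'm \<Rightarrow> 'k \<Rightarrow> bool) \<Rightarrow> bool" where
  "compatible_with_sequential_pairs C K J R \<longleftrightarrow>
     (\<forall>A\<in>Obj C. \<forall>B\<in>Obj C. \<forall>v\<in>Hom C A B. \<forall>w\<in>Hom C A B. R A B v (J A B w) \<longleftrightarrow> v = w) \<and>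
     (\<forall>A\<in>Obj C. \<forall>B1\<in>Obj C. \<forall>B2\<in>Obj C. \<forall>f1\<in>Hom C A B1. \<forall>f2\<in>Hom K A B2.
        \<exists>!h. h \<in> Hom K A (Prod C B1 B2) \<and>
          R A B1 f1 (Comp K A (Prod C B1 B2) B1 (J (Prod C B1 B2) B1 (Pr1 C B1 B2)) h) \<and>
          Comp K A (Prod C B1 B2) B2 (J (Prod C B1 B2) B2 (Pr2 C B1 B2)) h = f2) \<and>
     (\<forall>A\<in>Obj C. \<forall>B1\<in>Obj C. \<forall>B2\<in>Obj C. \<forall>f1\<in>Hom K A B1. \<forall>f2\<in>Hom C A B2.
        \<exists>!h. h \<in> Hom K A (Prod C B1 B2) \<and>
          Comp K A (Prod C B1 B2) B1 (J (Prod C B1 B2) B1 (Pr1 C B1 B2)) h = f1 \<and>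
          R A B2 f2 (Comp K A (Prod C B1 B2) B2 (J (Prod C B1 B2) B2 (Pr2 C B1 B2)) h))"


section \<open>The programmer's language for exceptions\<close>

definition exc_unit :: "('o, 'm, 'z) bicartesian_scheme \<Rightarrow> 'o \<Rightarrow> 'o \<Rightarrow> 'm" where
  "exc_unit C E X = Copr1 C X E"

definition exc_mult :: "('o, 'm, 'z) bicartesian_scheme \<Rightarrow> 'o \<Rightarrow> 'o \<Rightarrow> 'm" where
  "exc_mult C E X =
     copair C (Coprod C X E) E (Coprod C X E) (Ident C (Coprod C X E)) (Copr2 C X E)"

definition propagators :: "('o, 'm, 'z) bicartesian_scheme \<Rightarrow> 'o \<Rightarrow> ('o, 'm) category" where
  "propagators C E =
     \<lparr> Obj = Obj C,
       Hom = (\<lambda>A B. Hom C A (Coprod C B E)),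
       Ident = exc_unit C E,
       Comp = (\<lambda>A B D g f.
         Comp C A (Coprod C (Coprod C D E) E) (Coprod C D E) (exc_mult C E D)
           (Comp C A (Coprod C B E) (Coprod C (Coprod C D E) E)
             (coprod_map C B (Coprod C D E) E E g (Ident C E)) f)) \<rparr>"

definition pure_propagator ::
    "('o, 'm, 'z) bicartesian_scheme \<Rightarrow> 'o \<Rightarrow> 'o \<Rightarrow> 'o \<Rightarrow> 'm \<Rightarrow> 'm" where
  "pure_propagator C E A B v = Comp C A B (Coprod C B E) (exc_unit C E B) v"

definition is_normal_part ::
    "('o, 'm, 'z) bicartesian_scheme \<Rightarrow> 'o \<Rightarrow> 'o \<Rightarrow> 'o \<Rightarrow> 'm \<Rightarrow> 'o \<Rightarrow> 'm \<Rightarrow> 'm \<Rightarrow> bool" where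
  "is_normal_part C E A B f D i n \<longleftrightarrow>
     is_pullback C A B (Coprod C B E) f (Copr1 C B E) D i n"

definition is_abrupt_part ::
    "('o, 'm, 'z) bicartesian_scheme \<Rightarrow> 'o \<Rightarrow> 'o \<Rightarrow> 'o \<Rightarrow> 'm \<Rightarrow> 'o \<Rightarrow> 'm \<Rightarrow> 'm \<Rightarrow> bool" where
  "is_abrupt_part C E A B f D j a \<longleftrightarrow>
     is_pullback C A E (Coprod C B E) f (Copr2 C B E) D j a"

definition extensive_wrt :: "('o, 'm, 'z) bicartesian_scheme \<Rightarrow> 'o \<Rightarrow> bool" where
  "extensive_wrt C E \<longleftrightarrow>
     (\<forall>A\<in>Obj C. \<forall>B\<in>Obj C. \<forall>f\<in>Hom C A (Coprod C B E).
        \<exists>D i n X j a. is_normal_part C E A B f D i n \<and> is_abrupt_part C E A B f X j a \<and>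
          is_coproduct C D X A i j)"

text \<open>
  The relation \<open>v \<ggreater> f\<close>. It does not depend on the choice of the pullback, see
  \<open>dominates_iff\<close>.
\<close>

definition dominates ::
    "('o, 'm, 'z) bicartesian_scheme \<Rightarrow> 'o \<Rightarrow> 'o \<Rightarrow> 'o \<Rightarrow> 'm \<Rightarrow> 'm \<Rightarrow> bool" where
  "dominates C E A B v f \<longleftrightarrow> (\<exists>D i n. is_normal_part C E A B f D i n \<and> Comp C D A B v i = n)"

lemma dominates_iff:
  assumes C: "is_category C" and AB: "A \<in> Obj C" "B \<in> Obj C" and v: "v \<in> Hom C A B"
    and D: "is_normal_part C E A B f D i n"
  shows "dominates C E A B v f \<longleftrightarrow> Comp C D A B v i = n"
proof
  assume "dominates C E A B v f"
  then obtain D' i' n' where D': "is_normal_part C E A B f D' i' n'"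
    and eq: "Comp C D' A B v i' = n'"
    unfolding dominates_def by blast
  have D_simps: "D \<in> Obj C" "i \<in> Hom C D A" "n \<in> Hom C D B"
      "Comp C D A (Coprod C B E) f i = Comp C D B (Coprod C B E) (Copr1 C B E) n"
    using D unfolding is_normal_part_def is_pullback_def by auto
  have D'_simps: "D' \<in> Obj C" "i' \<in> Hom C D' A"
    using D' unfolding is_normal_part_def is_pullback_def by auto
  obtain k where k: "k \<in> Hom C D D'" "Comp C D D' A i' k = i" "Comp C D D' B n' k = n"
    using D' D_simps unfolding is_normal_part_def is_pullback_def by meson
  have "Comp C D D' B (Comp C D' A B v i') k = Comp C D A B v (Comp C D D' A i' k)"
    using C AB v D_simps(1) D'_simps k(1) unfolding is_category_def by blast
  then show "Comp C D A B v i = n"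
    using k eq by simp
qed (use D in \<open>auto simp: dominates_def\<close>)

end

theory Submission
  imports Defs
begin

text \<open>
  Everything is read off from generalized elements \<open>x : X \<rightarrow> A\<close>. Extensivity splits the domain of any
  \<open>f : A \<rightarrow> B + E\<close> into a normal and an abrupt part, so that equalities of morphisms out of \<open>A\<close> can be
  checked on elements with normal or abrupt image under \<open>f\<close>. The assumption does not say that
  the coprojections are monic and disjoint, but enough of this follows: if \<open>f\<close> is
  \<open>copr1 \<circ> u\<close> then \<open>i_f\<close> is an isomorphism, so \<open>copr1\<close> is monic, and if
  \<open>copr1 \<circ> b = copr2 \<circ> e\<close> on \<open>X\<close> then \<open>X\<close> is the coproduct of two copies of itself with identity
  coprojections, so that parallel morphisms out of \<open>X\<close> are equal. Hence a case where an element is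
  both normal and abrupt never obstructs an equality. The left pair is
  \<open>copr1 \<circ> \<langle>f1 \<circ> i, f2_normal\<rangle>\<close> on the normal part of \<open>f2\<close> and \<open>copr2 \<circ> f2_abrupt\<close> on its abrupt part;
  right pairs are left pairs for the product with its projections exchanged.
\<close>

section \<open>Universal properties as existence and uniqueness rules\<close>

lemma pullback_lift:
  assumes "is_pullback C A B Z f g P p q" "X \<in> Obj C" "a \<in> Hom C X A" "b \<in> Hom C X B"
    and "Comp C X A Z f a = Comp C X B Z g b"
  obtains k where "k \<in> Hom C X P" "Comp C X P A p k = a" "Comp C X P B q k = b"
proof -
  have "\<exists>!k. k \<in> Hom C X P \<and> Comp C X P A p k = a \<and> Comp C X P B q k = b"
    using assms by (simp add: is_pullback_def)
  then show thesis
    using that by blast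
qed

lemma coproduct_ex1:
  assumes "is_coproduct C A B S i j" "X \<in> Obj C" "f \<in> Hom C A X" "g \<in> Hom C B X"
  shows "\<exists>!h. h \<in> Hom C S X \<and> Comp C A S X h i = f \<and> Comp C B S X h j = g"
  using assms by (simp add: is_coproduct_def)

lemma product_ex1:
  assumes "is_product C A B P p q" "X \<in> Obj C" "f \<in> Hom C X A" "g \<in> Hom C X B"
  shows "\<exists>!h. h \<in> Hom C X P \<and> Comp C X P A p h = f \<and> Comp C X P B q h = g"
  using assms by (simp add: is_product_def)

lemma coproduct_lift:
  assumes "is_coproduct C A B S i j" "X \<in> Obj C" "f \<in> Hom C A X" "g \<in> Hom C B X"
  obtains h where "h \<in> Hom C S X" "Comp C A S X h i = f" "Comp C B S X h j = g"
  using ex1_implies_ex[OF coproduct_ex1[OF assms]] by blast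

lemma product_lift:
  assumes "is_product C A B P p q" "X \<in> Obj C" "f \<in> Hom C X A" "g \<in> Hom C X B"
  obtains h where "h \<in> Hom C X P" "Comp C X P A p h = f" "Comp C X P B q h = g"
  using ex1_implies_ex[OF product_ex1[OF assms]] by blast

lemma product_swap: "is_product C A B P p q \<Longrightarrow> is_product C B A P q p"
  unfolding is_product_def by (simp add: conj_commute conj_left_commute)

lemma coproduct_swap: "is_coproduct C A B S i j \<Longrightarrow> is_coproduct C B A S j i"
  unfolding is_coproduct_def by (simp add: conj_commute conj_left_commute)

section \<open>Categories with finite products and finite coproducts\<close>

locale bicartesian_category =
  fixes C :: "('o, 'm, 'z) bicartesian_scheme"
  assumes bicartesian: "is_bicartesian C"
begin

lemma category: "is_category C"
  using bicartesian by (simp add: is_bicartesian_def)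

lemma Ident_in [simp]: "A \<in> Obj C \<Longrightarrow> Ident C A \<in> Hom C A A"
  using category by (simp add: is_category_def)

lemma Comp_in [simp]:
  "\<lbrakk>A \<in> Obj C; B \<in> Obj C; D \<in> Obj C; f \<in> Hom C A B; g \<in> Hom C B D\<rbrakk> \<Longrightarrow> Comp C A B D g f \<in> Hom C A D"
  using category by (simp add: is_category_def)

lemma Comp_Ident_right [simp]:
  "\<lbrakk>A \<in> Obj C; B \<in> Obj C; f \<in> Hom C A B\<rbrakk> \<Longrightarrow> Comp C A A B f (Ident C A) = f"
  using category by (simp add: is_category_def)

lemma Comp_Ident_left [simp]:
  "\<lbrakk>A \<in> Obj C; B \<in> Obj C; f \<in> Hom C A B\<rbrakk> \<Longrightarrow> Comp C A B B (Ident C B) f = f"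
  using category by (simp add: is_category_def)

lemma Comp_assoc:
  "\<lbrakk>A \<in> Obj C; B \<in> Obj C; D \<in> Obj C; F \<in> Obj C; f \<in> Hom C A B; g \<in> Hom C B D; h \<in> Hom C D F\<rbrakk>
    \<Longrightarrow> Comp C A B F (Comp C B D F h g) f = Comp C A D F h (Comp C A B D g f)"
  using category by (simp add: is_category_def)

lemma product:
  "\<lbrakk>A \<in> Obj C; B \<in> Obj C\<rbrakk> \<Longrightarrow> is_product C A B (Prod C A B) (Pr1 C A B) (Pr2 C A B)"
  using bicartesian by (simp add: is_bicartesian_def)

lemma coproduct:
  "\<lbrakk>A \<in> Obj C; B \<in> Obj C\<rbrakk> \<Longrightarrow> is_coproduct C A B (Coprod C A B) (Copr1 C A B) (Copr2 C A B)"
  using bicartesian by (simp add: is_bicartesian_def)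

lemma Coprod_in [simp]:
  assumes "A \<in> Obj C" "B \<in> Obj C"
  shows "Coprod C A B \<in> Obj C" "Copr1 C A B \<in> Hom C A (Coprod C A B)"
    "Copr2 C A B \<in> Hom C B (Coprod C A B)"
  using coproduct[OF assms] by (simp_all add: is_coproduct_def)

lemma coproduct_eq:
  assumes "is_coproduct C A B S i j" "A \<in> Obj C" "B \<in> Obj C" "X \<in> Obj C"
    and "h \<in> Hom C S X" "k \<in> Hom C S X"
    and "Comp C A S X h i = Comp C A S X k i" "Comp C B S X h j = Comp C B S X k j"
  shows "h = k"
proof -
  have "S \<in> Obj C" "i \<in> Hom C A S" "j \<in> Hom C B S"
    using assms(1) by (simp_all add: is_coproduct_def)
  then have "Comp C A S X k i \<in> Hom C A X" "Comp C B S X k j \<in> Hom C B X"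
    using assms by simp_all
  from coproduct_ex1[OF assms(1,4) this] show ?thesis
    using assms(5-8) by blast
qed

lemma product_eq:
  assumes "is_product C A B P p q" "A \<in> Obj C" "B \<in> Obj C" "X \<in> Obj C"
    and "h \<in> Hom C X P" "k \<in> Hom C X P"
    and "Comp C X P A p h = Comp C X P A p k" "Comp C X P B q h = Comp C X P B q k"
  shows "h = k"
proof -
  have "P \<in> Obj C" "p \<in> Hom C P A" "q \<in> Hom C P B"
    using assms(1) by (simp_all add: is_product_def)
  then have "Comp C X P A p k \<in> Hom C X A" "Comp C X P B q k \<in> Hom C X B"
    using assms by simp_all
  from product_ex1[OF assms(1,4) this] show ?thesis
    using assms(5-8) by blast
qed

lemma copair:
  assumes "A \<in> Obj C" "B \<in> Obj C" "X \<in> Obj C" "f \<in> Hom C A X" "g \<in> Hom C B X"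
  shows "copair C A B X f g \<in> Hom C (Coprod C A B) X"
    and "Comp C A (Coprod C A B) X (copair C A B X f g) (Copr1 C A B) = f"
    and "Comp C B (Coprod C A B) X (copair C A B X f g) (Copr2 C A B) = g"
proof -
  note h = theI'[OF coproduct_ex1[OF coproduct[OF assms(1,2)] assms(3-5)]]
  show "copair C A B X f g \<in> Hom C (Coprod C A B) X"
    and "Comp C A (Coprod C A B) X (copair C A B X f g) (Copr1 C A B) = f"
    and "Comp C B (Coprod C A B) X (copair C A B X f g) (Copr2 C A B) = g"
    unfolding copair_def using h by simp_all
qed

end

section \<open>The Kleisli category of the exception monad, and conditionals\<close>

locale exception_category = bicartesian_category C
  for C :: "('o, 'm, 'z) bicartesian_scheme" +
  fixes E :: 'o
  assumes E_in [simp]: "E \<in> Obj C"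
begin

abbreviation exc ("T") where "T B \<equiv> Coprod C B E"
abbreviation normal ("\<iota>") where "\<iota> B \<equiv> Copr1 C B E"
abbreviation abrupt ("\<epsilon>") where "\<epsilon> B \<equiv> Copr2 C B E"

text \<open>The Kleisli extension of \<open>g\<close>, written as a single copair instead of the
  multiplication after \<open>g + id\<close>. This avoids the object \<open>T (T D)\<close>;
  \<open>exc_mult_coprod_map\<close> shows that the two agree.\<close>

definition bind :: "'o \<Rightarrow> 'o \<Rightarrow> 'm \<Rightarrow> 'm" where
  "bind B D g = copair C B E (T D) g (\<epsilon> D)"

lemma bind_simps [simp]:
  assumes "B \<in> Obj C" "D \<in> Obj C" "g \<in> Hom C B (T D)"
  shows "bind B D g \<in> Hom C (T B) (T D)"
    and "Comp C B (T B) (T D) (bind B D g) (\<iota> B) = g"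
    and "Comp C E (T B) (T D) (bind B D g) (\<epsilon> B) = \<epsilon> D"
  unfolding bind_def using copair[of B E "T D" g "\<epsilon> D"] assms by simp_all

lemma bind_normal [simp]:
  assumes "B \<in> Obj C" "D \<in> Obj C" "g \<in> Hom C B (T D)" "X \<in> Obj C" "x \<in> Hom C X B"
  shows "Comp C X (T B) (T D) (bind B D g) (Comp C X B (T B) (\<iota> B) x) = Comp C X B (T D) g x"
  using Comp_assoc[of X B "T B" "T D" x "\<iota> B" "bind B D g"] assms by simp

lemma bind_abrupt [simp]:
  assumes "B \<in> Obj C" "D \<in> Obj C" "g \<in> Hom C B (T D)" "X \<in> Obj C" "x \<in> Hom C X E"
  shows "Comp C X (T B) (T D) (bind B D g) (Comp C X E (T B) (\<epsilon> B) x) = Comp C X E (T D) (\<epsilon> D) x"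
  using Comp_assoc[of X E "T B" "T D" x "\<epsilon> B" "bind B D g"] assms by simp

lemma exc_eq:
  assumes "B \<in> Obj C" "X \<in> Obj C" "h \<in> Hom C (T B) X" "k \<in> Hom C (T B) X"
    and "Comp C B (T B) X h (\<iota> B) = Comp C B (T B) X k (\<iota> B)"
    and "Comp C E (T B) X h (\<epsilon> B) = Comp C E (T B) X k (\<epsilon> B)"
  shows "h = k"
  using coproduct_eq[OF coproduct[of B E]] assms by simp

lemma bind_unit: "B \<in> Obj C \<Longrightarrow> bind B B (\<iota> B) = Ident C (T B)"
  by (rule exc_eq[of B "T B"]) simp_all

text \<open>Both sides agree on the two coprojections of \<open>T A\<close>. This extension law
  makes composition of propagators associative.\<close>

lemma bind_bind:
  assumes "A \<in> Obj C" "B \<in> Obj C" "D \<in> Obj C" "f \<in> Hom C A (T B)" "g \<in> Hom C B (T D)"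
  shows "bind A D (Comp C A (T B) (T D) (bind B D g) f) =
    Comp C (T A) (T B) (T D) (bind B D g) (bind A B f)"
  by (rule exc_eq[of A "T D"]) (use assms in \<open>simp_all add: Comp_assoc\<close>)

lemma propagators_simps [simp]:
  "Obj (propagators C E) = Obj C"
  "Hom (propagators C E) A B = Hom C A (T B)"
  "Ident (propagators C E) A = \<iota> A"
  by (simp_all add: propagators_def exc_unit_def)

text \<open>On the first coprojection the multiplication cancels \<open>\<iota> (T D)\<close> and
  leaves \<open>g\<close>; on the second both sides give \<open>\<epsilon> D\<close>. Hence
  composition of propagators can be computed with \<open>bind\<close>.\<close>

lemma exc_mult_coprod_map:
  assumes "B \<in> Obj C" "D \<in> Obj C" "g \<in> Hom C B (T D)"
  shows "coprod_map C B (T D) E E g (Ident C E) \<in> Hom C (T B) (T (T D))"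
    and "exc_mult C E D \<in> Hom C (T (T D)) (T D)"
    and "Comp C (T B) (T (T D)) (T D) (exc_mult C E D) (coprod_map C B (T D) E E g (Ident C E)) =
      bind B D g"
proof -
  note m = copair[of "T D" E "T D" "Ident C (T D)" "\<epsilon> D", folded exc_mult_def]
  note c = copair[of B E "T (T D)" "Comp C B (T D) (T (T D)) (\<iota> (T D)) g"
      "Comp C E E (T (T D)) (\<epsilon> (T D)) (Ident C E)", folded coprod_map_def]
  show cin: "coprod_map C B (T D) E E g (Ident C E) \<in> Hom C (T B) (T (T D))"
    and min: "exc_mult C E D \<in> Hom C (T (T D)) (T D)"
    using assms m c by simp_all
  have m_normal: "Comp C B (T (T D)) (T D) (exc_mult C E D) (Comp C B (T D) (T (T D)) (\<iota> (T D)) g) = g"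
    using Comp_assoc[of B "T D" "T (T D)" "T D" g "\<iota> (T D)" "exc_mult C E D"] assms m by simp
  show "Comp C (T B) (T (T D)) (T D) (exc_mult C E D) (coprod_map C B (T D) E E g (Ident C E)) =
      bind B D g"
    by (rule exc_eq[of B "T D"]) (use assms cin min m c m_normal in \<open>simp_all add: Comp_assoc\<close>)
qed

lemma propagators_Comp [simp]:
  assumes "A \<in> Obj C" "B \<in> Obj C" "D \<in> Obj C" "f \<in> Hom C A (T B)" "g \<in> Hom C B (T D)"
  shows "Comp (propagators C E) A B D g f = Comp C A (T B) (T D) (bind B D g) f"
  using exc_mult_coprod_map[of B D g] assms
  by (simp add: propagators_def flip: Comp_assoc)

lemma pure_propagator_eq [simp]:
  "pure_propagator C E A B v = Comp C A B (T B) (\<iota> B) v"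
  by (simp add: pure_propagator_def exc_unit_def)

lemma propagators_category: "is_category (propagators C E)"
  unfolding is_category_def
  by (auto simp: bind_unit bind_bind Comp_assoc)

text \<open>Precomposing with a pure coprojection is ordinary composition in \<open>C\<close>, since
  \<open>bind\<close> cancels \<open>\<iota>\<close>. What remains is the universal property of the
  coproduct of \<open>A1\<close> and \<open>A2\<close> in \<open>C\<close>, with target
  \<open>T B\<close>.\<close>

lemma propagators_conditionals:
  "compatible_with_conditionals C (propagators C E) (pure_propagator C E)"
  unfolding compatible_with_conditionals_def
proof (intro ballI)
  fix A1 A2 B f1 f2
  assume "A1 \<in> Obj C" "A2 \<in> Obj C" "B \<in> Obj C"
    and "f1 \<in> Hom (propagators C E) A1 B" "f2 \<in> Hom (propagators C E) A2 B"
  moreover from this have "\<exists>!h. h \<in> Hom C (Coprod C A1 A2) (T B) \<and>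
      Comp C A1 (Coprod C A1 A2) (T B) h (Copr1 C A1 A2) = f1 \<and>
      Comp C A2 (Coprod C A1 A2) (T B) h (Copr2 C A1 A2) = f2"
    using coproduct[of A1 A2] by (simp add: is_coproduct_def)
  ultimately show "\<exists>!h. h \<in> Hom (propagators C E) (Coprod C A1 A2) B \<and>
      Comp (propagators C E) A1 (Coprod C A1 A2) B h
        (pure_propagator C E A1 (Coprod C A1 A2) (Copr1 C A1 A2)) = f1 \<and>
      Comp (propagators C E) A2 (Coprod C A1 A2) B h
        (pure_propagator C E A2 (Coprod C A1 A2) (Copr2 C A1 A2)) = f2"
    by (simp cong: conj_cong)
qed

end

section \<open>Extensivity: case distinctions and the relation between pure terms and
  propagators\<close>

locale extensive_exception_category = exception_category C E
  for C :: "('o, 'm, 'z) bicartesian_scheme" and E +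
  assumes extensive: "extensive_wrt C E"
begin

lemma split:
  assumes "A \<in> Obj C" "B \<in> Obj C" "f \<in> Hom C A (T B)"
  obtains D i n X j a where "D \<in> Obj C" "i \<in> Hom C D A" "n \<in> Hom C D B"
    "Comp C D A (T B) f i = Comp C D B (T B) (\<iota> B) n"
    "X \<in> Obj C" "j \<in> Hom C X A" "a \<in> Hom C X E"
    "Comp C X A (T B) f j = Comp C X E (T B) (\<epsilon> B) a"
    "is_pullback C A B (T B) f (\<iota> B) D i n" "is_pullback C A E (T B) f (\<epsilon> B) X j a"
    "is_coproduct C D X A i j"
proof -
  obtain D i n X j a where *: "is_pullback C A B (T B) f (\<iota> B) D i n"
      "is_pullback C A E (T B) f (\<epsilon> B) X j a" "is_coproduct C D X A i j"
    using extensive assms unfolding extensive_wrt_def is_normal_part_def is_abrupt_part_def by metis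
  from *(1,2) show thesis
    unfolding is_pullback_def by (intro that[OF _ _ _ _ _ _ _ _ *]) simp_all
qed

text \<open>The two cases are applied to the coprojections \<open>i\<close> and \<open>j\<close> of
  the decomposition of \<open>A\<close> along \<open>f\<close>, which are jointly epic. Stating them
  for all elements keeps the chosen decomposition out of later proofs.\<close>

lemma eq_by_cases:
  assumes "A \<in> Obj C" "B \<in> Obj C" "f \<in> Hom C A (T B)" "Z \<in> Obj C" "u \<in> Hom C A Z" "v \<in> Hom C A Z"
    and normal: "\<And>X x n. \<lbrakk>X \<in> Obj C; x \<in> Hom C X A; n \<in> Hom C X B;
        Comp C X A (T B) f x = Comp C X B (T B) (\<iota> B) n\<rbrakk> \<Longrightarrow> Comp C X A Z u x = Comp C X A Z v x"
    and abrupt: "\<And>X x a. \<lbrakk>X \<in> Obj C; x \<in> Hom C X A; a \<in> Hom C X E;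
        Comp C X A (T B) f x = Comp C X E (T B) (\<epsilon> B) a\<rbrakk> \<Longrightarrow> Comp C X A Z u x = Comp C X A Z v x"
  shows "u = v"
  using split[OF assms(1-3)] coproduct_eq[OF _ _ _ assms(4-6)] normal abrupt by metis

text \<open>Once \<open>i\<close> has a section it also has a retraction \<open>h\<close>, and every
  section \<open>m\<close> then equals \<open>h \<circ> i \<circ> m = h\<close>.\<close>

lemma sections_of_coprojection_eq:
  assumes "is_coproduct C D X A i j" "D \<in> Obj C" "X \<in> Obj C"
    and k: "k \<in> Hom C A D" "Comp C A D A i k = Ident C A"
    and l: "l \<in> Hom C A D" "Comp C A D A i l = Ident C A"
  shows "k = l"
proof -
  have [simp]: "A \<in> Obj C" "i \<in> Hom C D A" "j \<in> Hom C X A"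
    using assms(1) by (simp_all add: is_coproduct_def)
  \<comment> \<open>Here \<open>h\<close> is the copair of the identity and
    \<open>k \<circ> j\<close>; the section \<open>k\<close> supplies the morphism
    \<open>X \<rightarrow> D\<close> that the copair requires.\<close>
  obtain h where h: "h \<in> Hom C A D" "Comp C D A D h i = Ident C D"
    using coproduct_lift[OF assms(1), of D "Ident C D" "Comp C X A D k j"] assms by force
  have "m = h" if "m \<in> Hom C A D" "Comp C A D A i m = Ident C A" for m
    using Comp_assoc[of A D A D m i h] h that assms by simp
  then show ?thesis
    using k l by metis
qed

text \<open>Pull \<open>\<iota> B\<close> back along the common composite. Each of \<open>u\<close>
  and \<open>v\<close>, together with the identity of \<open>X\<close>, lifts to the pullback. The
  lifts are sections of the coprojection \<open>i\<close>, so they coincide, and \<open>n\<close>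
  recovers \<open>u\<close> and \<open>v\<close> from them.\<close>

lemma normal_monic:
  assumes "X \<in> Obj C" "B \<in> Obj C" "u \<in> Hom C X B" "v \<in> Hom C X B"
    and "Comp C X B (T B) (\<iota> B) u = Comp C X B (T B) (\<iota> B) v"
  shows "u = v"
proof -
  let ?f = "Comp C X B (T B) (\<iota> B) u"
  have f: "?f \<in> Hom C X (T B)" using assms by simp
  obtain D i n Y j a where s: "D \<in> Obj C" "Y \<in> Obj C" "is_coproduct C D Y X i j"
    and pb: "is_pullback C X B (T B) ?f (\<iota> B) D i n"
    using split[OF assms(1,2) f] by metis
  obtain k where k: "k \<in> Hom C X D" "Comp C X D X i k = Ident C X" "Comp C X D B n k = u"
    using pullback_lift[OF pb, of X "Ident C X" u] assms f by auto
  obtain l where l: "l \<in> Hom C X D" "Comp C X D X i l = Ident C X" "Comp C X D B n l = v"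
    using pullback_lift[OF pb, of X "Ident C X" v] assms f by auto
  show ?thesis
    using sections_of_coprojection_eq[OF s(3,1,2) k(1,2) l(1,2)] k(3) l(3) by simp
qed

text \<open>The argument of \<open>normal_monic\<close> for the pullback of
  \<open>\<epsilon> B\<close>, with the coproduct swapped so that \<open>j\<close> takes the place
  of \<open>i\<close>.\<close>

lemma abrupt_monic:
  assumes "X \<in> Obj C" "B \<in> Obj C" "u \<in> Hom C X E" "v \<in> Hom C X E"
    and "Comp C X E (T B) (\<epsilon> B) u = Comp C X E (T B) (\<epsilon> B) v"
  shows "u = v"
proof -
  let ?f = "Comp C X E (T B) (\<epsilon> B) u"
  have f: "?f \<in> Hom C X (T B)" using assms by simp
  obtain D i n Y j a where s: "D \<in> Obj C" "Y \<in> Obj C" "is_coproduct C D Y X i j"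
    and pb: "is_pullback C X E (T B) ?f (\<epsilon> B) Y j a"
    using split[OF assms(1,2) f] by metis
  obtain k where k: "k \<in> Hom C X Y" "Comp C X Y X j k = Ident C X" "Comp C X Y E a k = u"
    using pullback_lift[OF pb, of X "Ident C X" u] assms f by auto
  obtain l where l: "l \<in> Hom C X Y" "Comp C X Y X j l = Ident C X" "Comp C X Y E a l = v"
    using pullback_lift[OF pb, of X "Ident C X" v] assms f by auto
  show ?thesis
    using sections_of_coprojection_eq[OF coproduct_swap[OF s(3)] s(2,1) k(1,2) l(1,2)] k(3) l(3)
    by simp
qed

text \<open>In the decomposition along the common composite both coprojections have sections,
  \<open>k\<close> and \<open>l\<close>. Glue \<open>h\<close> from \<open>u\<close> on
  \<open>D\<close> and \<open>v\<close> on \<open>Y\<close>: precomposing with \<open>k\<close>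
  shows \<open>h = u\<close>, with \<open>l\<close> shows \<open>h = v\<close>. This takes the place
  of disjointness of the coprojections.\<close>

lemma normal_abrupt_eq:
  assumes "X \<in> Obj C" "B \<in> Obj C" "b \<in> Hom C X B" "e \<in> Hom C X E"
    and "Comp C X B (T B) (\<iota> B) b = Comp C X E (T B) (\<epsilon> B) e"
    and "Z \<in> Obj C" "u \<in> Hom C X Z" "v \<in> Hom C X Z"
  shows "u = v"
proof -
  let ?f = "Comp C X B (T B) (\<iota> B) b"
  have f: "?f \<in> Hom C X (T B)" using assms by simp
  obtain D i n Y j a where s: "D \<in> Obj C" "i \<in> Hom C D X" "Y \<in> Obj C" "j \<in> Hom C Y X"
    and co: "is_coproduct C D Y X i j"
    and pb1: "is_pullback C X B (T B) ?f (\<iota> B) D i n"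
    and pb2: "is_pullback C X E (T B) ?f (\<epsilon> B) Y j a"
    using split[OF assms(1,2) f] by metis
  obtain k where k: "k \<in> Hom C X D" "Comp C X D X i k = Ident C X"
    using pullback_lift[OF pb1, of X "Ident C X" b] assms f by auto
  obtain l where l: "l \<in> Hom C X Y" "Comp C X Y X j l = Ident C X"
    using pullback_lift[OF pb2, of X "Ident C X" e] assms f by auto
  obtain h where h: "h \<in> Hom C X Z" "Comp C D X Z h i = Comp C D X Z u i"
      "Comp C Y X Z h j = Comp C Y X Z v j"
    using coproduct_lift[OF co assms(6) Comp_in[OF s(1) assms(1,6) s(2) assms(7)]
        Comp_in[OF s(3) assms(1,6) s(4) assms(8)]] by blast
  have "Comp C X D Z (Comp C D X Z h i) k = h" "Comp C X D Z (Comp C D X Z u i) k = u"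
    using h(1) k s assms(1,6,7) by (simp_all add: Comp_assoc)
  then have "h = u"
    unfolding h(2) by metis
  have "Comp C X Y Z (Comp C Y X Z h j) l = h" "Comp C X Y Z (Comp C Y X Z v j) l = v"
    using h(1) l s assms(1,6,8) by (simp_all add: Comp_assoc)
  then have "h = v"
    unfolding h(3) by metis
  with \<open>h = u\<close> show ?thesis by metis
qed

text \<open>Every \<open>x\<close> with normal image under \<open>f\<close> factors through the
  pullback \<open>i\<close>, so testing at \<open>i\<close> amounts to testing at all such
  \<open>x\<close>. The resulting criterion mentions no chosen pullback.\<close>

lemma dominates_elements_iff:
  assumes "A \<in> Obj C" "B \<in> Obj C" "v \<in> Hom C A B" "f \<in> Hom C A (T B)"
  shows "dominates C E A B v f \<longleftrightarrow>
    (\<forall>X x b. X \<in> Obj C \<longrightarrow> x \<in> Hom C X A \<longrightarrow> b \<in> Hom C X B \<longrightarrow>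
      Comp C X A (T B) f x = Comp C X B (T B) (\<iota> B) b \<longrightarrow> Comp C X A B v x = b)"
proof -
  obtain D i n where D: "D \<in> Obj C" "i \<in> Hom C D A" "n \<in> Hom C D B"
      "Comp C D A (T B) f i = Comp C D B (T B) (\<iota> B) n"
    and pb: "is_pullback C A B (T B) f (\<iota> B) D i n"
    using split[OF assms(1,2,4)] by metis
  have "Comp C X A B v x = b"
    if vi: "Comp C D A B v i = n" and X: "X \<in> Obj C" "x \<in> Hom C X A" "b \<in> Hom C X B"
      and eq: "Comp C X A (T B) f x = Comp C X B (T B) (\<iota> B) b" for X x b
  proof -
    obtain k where "k \<in> Hom C X D" "Comp C X D A i k = x" "Comp C X D B n k = b"
      using pullback_lift[OF pb X eq] by metis
    then show ?thesis
      using Comp_assoc[of X D A B k i v] assms D X vi by simp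
  qed
  then show ?thesis
    using dominates_iff[OF category assms(1-3)] D pb unfolding is_normal_part_def by metis
qed

text \<open>Evaluating at the identity of \<open>A\<close> gives \<open>v = w\<close>; conversely,
  \<open>normal_monic\<close> cancels \<open>\<iota> B\<close>.\<close>

lemma dominates_pure_iff:
  assumes "A \<in> Obj C" "B \<in> Obj C" "v \<in> Hom C A B" "w \<in> Hom C A B"
  shows "dominates C E A B v (Comp C A B (T B) (\<iota> B) w) \<longleftrightarrow> v = w"
proof -
  have "w = v" if "\<forall>X x b. X \<in> Obj C \<longrightarrow> x \<in> Hom C X A \<longrightarrow> b \<in> Hom C X B \<longrightarrow>
      Comp C X A (T B) (Comp C A B (T B) (\<iota> B) w) x = Comp C X B (T B) (\<iota> B) b \<longrightarrow>
      Comp C X A B v x = b"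
    using that[rule_format, of A "Ident C A" w] assms by simp
  moreover have "Comp C X A B w x = b" if "X \<in> Obj C" "x \<in> Hom C X A" "b \<in> Hom C X B"
      "Comp C X A (T B) (Comp C A B (T B) (\<iota> B) w) x = Comp C X B (T B) (\<iota> B) b" for X x b
    using normal_monic[of X B "Comp C X A B w x" b] that assms by (simp add: Comp_assoc)
  ultimately show ?thesis
    using assms by (subst dominates_elements_iff) auto
qed

text \<open>Injectivity of the embedding of pure terms is monicity of
  \<open>\<iota>\<close>.\<close>

lemma language: "language_with_effects C (propagators C E) (pure_propagator C E)"
  unfolding language_with_effects_def
  using bicartesian propagators_category
  by (auto simp: Comp_assoc intro!: inj_onI intro: normal_monic)

section \<open>Existence and uniqueness of left and right pairs\<close>

abbreviation map_exc ("M") where "M A B v \<equiv> bind A B (Comp C A B (T B) (\<iota> B) v)"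

text \<open>\<open>M P B1 p\<close> is \<open>p + id\<close>, so composing with it is Kleisli
  composition with the pure propagator of \<open>p\<close>. An arbitrary product cone
  \<open>P\<close>, \<open>p\<close>, \<open>q\<close> is allowed so that exchanging
  \<open>p\<close> and \<open>q\<close> yields right pairs.\<close>

lemma left_pair_ex:
  assumes obj [simp]: "A \<in> Obj C" "B1 \<in> Obj C" "B2 \<in> Obj C"
    and prod: "is_product C B1 B2 P p q"
    and f1 [simp]: "f1 \<in> Hom C A B1" and f2 [simp]: "f2 \<in> Hom C A (T B2)"
  shows "\<exists>h. h \<in> Hom C A (T P) \<and>
    dominates C E A B1 f1 (Comp C A (T P) (T B1) (M P B1 p) h) \<and>
    Comp C A (T P) (T B2) (M P B2 q) h = f2"
proof -
  have [simp]: "P \<in> Obj C" "p \<in> Hom C P B1" "q \<in> Hom C P B2"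
    using prod by (simp_all add: is_product_def)
  obtain D i n X j a where s [simp]: "D \<in> Obj C" "i \<in> Hom C D A" "n \<in> Hom C D B2"
    and fi: "Comp C D A (T B2) f2 i = Comp C D B2 (T B2) (\<iota> B2) n"
    and t [simp]: "X \<in> Obj C" "j \<in> Hom C X A" "a \<in> Hom C X E"
    and fj: "Comp C X A (T B2) f2 j = Comp C X E (T B2) (\<epsilon> B2) a"
    and pb1: "is_pullback C A B2 (T B2) f2 (\<iota> B2) D i n"
    and pb2: "is_pullback C A E (T B2) f2 (\<epsilon> B2) X j a"
    and co: "is_coproduct C D X A i j"
    using split[OF obj(1,3) f2] by metis
  obtain m where m [simp]: "m \<in> Hom C D P" "Comp C D P B1 p m = Comp C D A B1 f1 i"
      "Comp C D P B2 q m = n"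
    using product_lift[OF prod, of D "Comp C D A B1 f1 i" n] by auto
  obtain h where h [simp]: "h \<in> Hom C A (T P)"
      "Comp C D A (T P) h i = Comp C D P (T P) (\<iota> P) m"
      "Comp C X A (T P) h j = Comp C X E (T P) (\<epsilon> P) a"
    using coproduct_lift[OF co, of "T P" "Comp C D P (T P) (\<iota> P) m" "Comp C X E (T P) (\<epsilon> P) a"]
    by auto
  have "Comp C A (T P) (T B2) (M P B2 q) h = f2"
    by (rule coproduct_eq[OF co, of "T B2"]) (simp_all add: Comp_assoc fi fj)
  moreover
  \<comment> \<open>\<open>g\<close> is the first component of the pair: it agrees with the
    propagator of \<open>f1\<close> on the normal part of \<open>f2\<close> and is abrupt on the
    abrupt part.\<close>
  define g where "g = Comp C A (T P) (T B1) (M P B1 p) h"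
  have g [simp]: "g \<in> Hom C A (T B1)"
    and gi: "Comp C D A (T B1) g i = Comp C D A (T B1) (Comp C A B1 (T B1) (\<iota> B1) f1) i"
    and gj: "Comp C X A (T B1) g j = Comp C X E (T B1) (\<epsilon> B1) a"
    by (simp_all add: g_def Comp_assoc)
  have "dominates C E A B1 f1 g"
    unfolding dominates_elements_iff[OF obj(1,2) f1 g]
  proof (intro allI impI)
    fix Y y b
    assume Y [simp]: "Y \<in> Obj C" "y \<in> Hom C Y A" "b \<in> Hom C Y B1"
      and gy: "Comp C Y A (T B1) g y = Comp C Y B1 (T B1) (\<iota> B1) b"
    \<comment> \<open>The values of \<open>g\<close> are known only on the two parts of
      \<open>A\<close> given by \<open>f2\<close>, so \<open>Y\<close> is split along
      \<open>f2 \<circ> y\<close>.\<close>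
    show "Comp C Y A B1 f1 y = b"
    proof (rule eq_by_cases[of Y B2 "Comp C Y A (T B2) f2 y" B1])
      fix W w c
      assume W [simp]: "W \<in> Obj C" "w \<in> Hom C W Y" "c \<in> Hom C W B2"
        and eq: "Comp C W Y (T B2) (Comp C Y A (T B2) f2 y) w = Comp C W B2 (T B2) (\<iota> B2) c"
      obtain k where k [simp]: "k \<in> Hom C W D" "Comp C W D A i k = Comp C W Y A y w"
        using pullback_lift[OF pb1, of W "Comp C W Y A y w" c] eq by (auto simp: Comp_assoc)
      \<comment> \<open>Both \<open>b \<circ> w\<close> and \<open>f1 \<circ> y \<circ> w\<close>
        become \<open>g \<circ> y \<circ> w\<close> under \<open>\<iota> B1\<close>, which is
        monic.\<close>
      have "Comp C W B1 (T B1) (\<iota> B1) (Comp C W Y B1 b w) =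
          Comp C W Y (T B1) (Comp C Y A (T B1) g y) w"
        by (subst gy) (simp add: Comp_assoc)
      also have "\<dots> = Comp C W D (T B1) (Comp C D A (T B1) g i) k"
        by (simp add: Comp_assoc)
      also have "\<dots> = Comp C W B1 (T B1) (\<iota> B1) (Comp C W Y B1 (Comp C Y A B1 f1 y) w)"
        unfolding gi by (simp add: Comp_assoc)
      finally show "Comp C W Y B1 (Comp C Y A B1 f1 y) w = Comp C W Y B1 b w"
        by (rule normal_monic[OF _ _ _ _ sym, rotated 4]) simp_all
    next
      fix W w c
      assume W [simp]: "W \<in> Obj C" "w \<in> Hom C W Y" "c \<in> Hom C W E"
        and eq: "Comp C W Y (T B2) (Comp C Y A (T B2) f2 y) w = Comp C W E (T B2) (\<epsilon> B2) c"
      obtain k where k [simp]: "k \<in> Hom C W X" "Comp C W X A j k = Comp C W Y A y w"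
        using pullback_lift[OF pb2, of W "Comp C W Y A y w" c] eq by (auto simp: Comp_assoc)
      \<comment> \<open>Here \<open>g\<close> is normal at \<open>y \<circ> w\<close> by
        \<open>gy\<close> and abrupt there by \<open>gj\<close>, so any two parallel morphisms out
        of \<open>W\<close> agree.\<close>
      have "Comp C W B1 (T B1) (\<iota> B1) (Comp C W Y B1 b w) =
          Comp C W Y (T B1) (Comp C Y A (T B1) g y) w"
        by (subst gy) (simp add: Comp_assoc)
      also have "\<dots> = Comp C W X (T B1) (Comp C X A (T B1) g j) k"
        by (simp add: Comp_assoc)
      also have "\<dots> = Comp C W E (T B1) (\<epsilon> B1) (Comp C W X E a k)"
        unfolding gj by (simp add: Comp_assoc)
      finally show "Comp C W Y B1 (Comp C Y A B1 f1 y) w = Comp C W Y B1 b w"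
        by (rule normal_abrupt_eq[where Z = B1, rotated 4]) simp_all
    qed simp_all
  qed
  ultimately show ?thesis
    using h(1) unfolding g_def by blast
qed

text \<open>Where \<open>h\<close> is normal with value \<open>n\<close>, its two components are
  normal with values \<open>p \<circ> n\<close> and \<open>q \<circ> n\<close>; domination
  identifies the first of these with the value of \<open>f1\<close>.\<close>

lemma normal_left_pair:
  assumes [simp]: "A \<in> Obj C" "B1 \<in> Obj C" "B2 \<in> Obj C" "P \<in> Obj C" "p \<in> Hom C P B1" "q \<in> Hom C P B2"
    and [simp]: "f1 \<in> Hom C A B1" "h \<in> Hom C A (T P)"
    and dom: "dominates C E A B1 f1 (Comp C A (T P) (T B1) (M P B1 p) h)"
    and [simp]: "X \<in> Obj C" "x \<in> Hom C X A" "n \<in> Hom C X P"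
    and [simp]: "Comp C X A (T P) h x = Comp C X P (T P) (\<iota> P) n"
  shows "Comp C X P B1 p n = Comp C X A B1 f1 x"
    and "Comp C X A (T B2) (Comp C A (T P) (T B2) (M P B2 q) h) x =
      Comp C X B2 (T B2) (\<iota> B2) (Comp C X P B2 q n)"
proof -
  let ?g = "Comp C A (T P) (T B1) (M P B1 p) h"
  have g: "?g \<in> Hom C A (T B1)" by simp
  have "Comp C X A (T B1) ?g x = Comp C X B1 (T B1) (\<iota> B1) (Comp C X P B1 p n)"
    by (simp add: Comp_assoc)
  moreover have "Comp C X P B1 p n \<in> Hom C X B1" by simp
  ultimately show "Comp C X P B1 p n = Comp C X A B1 f1 x"
    using dominates_elements_iff[OF assms(1,2,7) g] dom assms(10,11) by metis
qed (simp add: Comp_assoc)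

text \<open>The map \<open>q + id\<close> leaves exceptions unchanged.\<close>

lemma abrupt_left_pair:
  assumes "A \<in> Obj C" "B2 \<in> Obj C" "P \<in> Obj C" "q \<in> Hom C P B2" "h \<in> Hom C A (T P)"
    and "X \<in> Obj C" "x \<in> Hom C X A" "a \<in> Hom C X E"
    and "Comp C X A (T P) h x = Comp C X E (T P) (\<epsilon> P) a"
  shows "Comp C X A (T B2) (Comp C A (T P) (T B2) (M P B2 q) h) x = Comp C X E (T B2) (\<epsilon> B2) a"
  using assms by (simp add: Comp_assoc)

text \<open>Compare \<open>h\<close> and \<open>k\<close> on elements. Normal values agree
  componentwise, abrupt values agree through \<open>f2\<close>, and where one is normal and the
  other abrupt, \<open>f2\<close> would be both.\<close>

lemma left_pair_unique:
  assumes obj [simp]: "A \<in> Obj C" "B1 \<in> Obj C" "B2 \<in> Obj C"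
    and prod: "is_product C B1 B2 P p q"
    and f1 [simp]: "f1 \<in> Hom C A B1"
    and h [simp]: "h \<in> Hom C A (T P)"
    and hf1: "dominates C E A B1 f1 (Comp C A (T P) (T B1) (M P B1 p) h)"
    and hf2: "Comp C A (T P) (T B2) (M P B2 q) h = f2"
    and k [simp]: "k \<in> Hom C A (T P)"
    and kf1: "dominates C E A B1 f1 (Comp C A (T P) (T B1) (M P B1 p) k)"
    and kf2: "Comp C A (T P) (T B2) (M P B2 q) k = f2"
  shows "h = k"
proof -
  have P [simp]: "P \<in> Obj C" "p \<in> Hom C P B1" "q \<in> Hom C P B2"
    using prod by (simp_all add: is_product_def)
  note hn = normal_left_pair[OF obj P f1 h hf1, unfolded hf2]
    and ha = abrupt_left_pair[OF obj(1,3) P(1,3) h, unfolded hf2]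
    and kn = normal_left_pair[OF obj P f1 k kf1, unfolded kf2]
    and ka = abrupt_left_pair[OF obj(1,3) P(1,3) k, unfolded kf2]
  have normal_eq: "n = n'"
    if "X \<in> Obj C" "x \<in> Hom C X A" "n \<in> Hom C X P" "n' \<in> Hom C X P"
      "Comp C X A (T P) h x = Comp C X P (T P) (\<iota> P) n"
      "Comp C X A (T P) k x = Comp C X P (T P) (\<iota> P) n'" for X x n n'
    by (rule product_eq[OF prod, of X])
      (use hn[of X x n] kn[of X x n'] that
        normal_monic[of X B2 "Comp C X P B2 q n" "Comp C X P B2 q n'"] in simp_all)
  have abrupt_eq: "a = a'"
    if "X \<in> Obj C" "x \<in> Hom C X A" "a \<in> Hom C X E" "a' \<in> Hom C X E"
      "Comp C X A (T P) h x = Comp C X E (T P) (\<epsilon> P) a"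
      "Comp C X A (T P) k x = Comp C X E (T P) (\<epsilon> P) a'" for X x a a'
    by (rule abrupt_monic[of X B2]) (use ha[of X x a] ka[of X x a'] that in simp_all)
  \<comment> \<open>The disjunction covers both mixed cases: in each, \<open>f2 \<circ> x\<close> is
    \<open>\<iota> B2 \<circ> q \<circ> n\<close> and also \<open>\<epsilon> B2 \<circ> a\<close>,
    so \<open>normal_abrupt_eq\<close> identifies all parallel morphisms out of
    \<open>X\<close>.\<close>
  have mixed_eq: "Comp C X A (T P) h x = Comp C X A (T P) k x"
    if X: "X \<in> Obj C" "x \<in> Hom C X A" "n \<in> Hom C X P" "a \<in> Hom C X E"
      and "Comp C X A (T P) h x = Comp C X P (T P) (\<iota> P) n \<and>
          Comp C X A (T P) k x = Comp C X E (T P) (\<epsilon> P) a \<or>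
        Comp C X A (T P) k x = Comp C X P (T P) (\<iota> P) n \<and>
          Comp C X A (T P) h x = Comp C X E (T P) (\<epsilon> P) a" for X x n a
  proof (rule normal_abrupt_eq[of X B2 "Comp C X P B2 q n" a "T P"])
    show "Comp C X B2 (T B2) (\<iota> B2) (Comp C X P B2 q n) = Comp C X E (T B2) (\<epsilon> B2) a"
      using that(5) hn[OF X(1-3)] ka[OF X(1,2,4)] kn[OF X(1-3)] ha[OF X(1,2,4)] by auto
  qed (use X in simp_all)
  \<comment> \<open>Split \<open>A\<close> along \<open>h\<close>, then each element
    \<open>x\<close> along \<open>k \<circ> x\<close>; the four combinations are settled by
    \<open>normal_eq\<close>, \<open>mixed_eq\<close> (twice) and \<open>abrupt_eq\<close>.\<close>
  show ?thesis
  proof (rule eq_by_cases[of A P h "T P"])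
    fix X x n
    assume X [simp]: "X \<in> Obj C" "x \<in> Hom C X A" "n \<in> Hom C X P"
      and hx: "Comp C X A (T P) h x = Comp C X P (T P) (\<iota> P) n"
    show "Comp C X A (T P) h x = Comp C X A (T P) k x"
    proof (rule eq_by_cases[of X P "Comp C X A (T P) k x" "T P"])
      fix Y y n'
      assume [simp]: "Y \<in> Obj C" "y \<in> Hom C Y X" "n' \<in> Hom C Y P"
        and ky: "Comp C Y X (T P) (Comp C X A (T P) k x) y = Comp C Y P (T P) (\<iota> P) n'"
      then show "Comp C Y X (T P) (Comp C X A (T P) h x) y = Comp C Y X (T P) (Comp C X A (T P) k x) y"
        using normal_eq[of Y "Comp C Y X A x y" "Comp C Y X P n y" n']
          arg_cong[OF hx, of "\<lambda>z. Comp C Y X (T P) z y"]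
        by (simp add: Comp_assoc)
    next
      fix Y y a'
      assume [simp]: "Y \<in> Obj C" "y \<in> Hom C Y X" "a' \<in> Hom C Y E"
        and ky: "Comp C Y X (T P) (Comp C X A (T P) k x) y = Comp C Y E (T P) (\<epsilon> P) a'"
      then show "Comp C Y X (T P) (Comp C X A (T P) h x) y = Comp C Y X (T P) (Comp C X A (T P) k x) y"
        using mixed_eq[of Y "Comp C Y X A x y" "Comp C Y X P n y" a']
          arg_cong[OF hx, of "\<lambda>z. Comp C Y X (T P) z y"]
        by (simp add: Comp_assoc)
    qed simp_all
  next
    fix X x a
    assume X [simp]: "X \<in> Obj C" "x \<in> Hom C X A" "a \<in> Hom C X E"
      and hx: "Comp C X A (T P) h x = Comp C X E (T P) (\<epsilon> P) a"
    show "Comp C X A (T P) h x = Comp C X A (T P) k x"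
    proof (rule eq_by_cases[of X P "Comp C X A (T P) k x" "T P"])
      fix Y y n'
      assume [simp]: "Y \<in> Obj C" "y \<in> Hom C Y X" "n' \<in> Hom C Y P"
        and ky: "Comp C Y X (T P) (Comp C X A (T P) k x) y = Comp C Y P (T P) (\<iota> P) n'"
      then show "Comp C Y X (T P) (Comp C X A (T P) h x) y = Comp C Y X (T P) (Comp C X A (T P) k x) y"
        using mixed_eq[of Y "Comp C Y X A x y" n' "Comp C Y X E a y"]
          arg_cong[OF hx, of "\<lambda>z. Comp C Y X (T P) z y"]
        by (simp add: Comp_assoc)
    next
      fix Y y a'
      assume [simp]: "Y \<in> Obj C" "y \<in> Hom C Y X" "a' \<in> Hom C Y E"
        and ky: "Comp C Y X (T P) (Comp C X A (T P) k x) y = Comp C Y E (T P) (\<epsilon> P) a'"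
      then show "Comp C Y X (T P) (Comp C X A (T P) h x) y = Comp C Y X (T P) (Comp C X A (T P) k x) y"
        using abrupt_eq[of Y "Comp C Y X A x y" "Comp C Y X E a y" a']
          arg_cong[OF hx, of "\<lambda>z. Comp C Y X (T P) z y"]
        by (simp add: Comp_assoc)
    qed simp_all
  qed simp_all
qed

lemma left_pair_ex1:
  assumes "A \<in> Obj C" "B1 \<in> Obj C" "B2 \<in> Obj C" "is_product C B1 B2 P p q"
    and "f1 \<in> Hom C A B1" "f2 \<in> Hom C A (T B2)"
  shows "\<exists>!h. h \<in> Hom (propagators C E) A P \<and>
    dominates C E A B1 f1 (Comp (propagators C E) A P B1 (pure_propagator C E P B1 p) h) \<and>
    Comp (propagators C E) A P B2 (pure_propagator C E P B2 q) h = f2"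
proof -
  have "P \<in> Obj C" "p \<in> Hom C P B1" "q \<in> Hom C P B2"
    using assms(4) by (simp_all add: is_product_def)
  moreover have "\<exists>!h. h \<in> Hom C A (T P) \<and>
      dominates C E A B1 f1 (Comp C A (T P) (T B1) (M P B1 p) h) \<and>
      Comp C A (T P) (T B2) (M P B2 q) h = f2"
    using left_pair_ex[OF assms] left_pair_unique[OF assms(1-5)] by blast
  ultimately show ?thesis
    using assms by (simp cong: conj_cong)
qed

lemma sequential_pairs:
  "compatible_with_sequential_pairs C (propagators C E) (pure_propagator C E) (dominates C E)"
  unfolding compatible_with_sequential_pairs_def
proof (intro conjI ballI)
  fix A B1 B2 f1 f2
  assume "A \<in> Obj C" "B1 \<in> Obj C" "B2 \<in> Obj C"
    and "f1 \<in> Hom C A B1" "f2 \<in> Hom (propagators C E) A B2"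
  then show "\<exists>!h. h \<in> Hom (propagators C E) A (Prod C B1 B2) \<and>
      dominates C E A B1 f1 (Comp (propagators C E) A (Prod C B1 B2) B1
        (pure_propagator C E (Prod C B1 B2) B1 (Pr1 C B1 B2)) h) \<and>
      Comp (propagators C E) A (Prod C B1 B2) B2
        (pure_propagator C E (Prod C B1 B2) B2 (Pr2 C B1 B2)) h = f2"
    using product[of B1 B2] by (intro left_pair_ex1) simp_all
next
  fix A B1 B2 f1 f2
  assume "A \<in> Obj C" "B1 \<in> Obj C" "B2 \<in> Obj C"
    and "f1 \<in> Hom (propagators C E) A B1" "f2 \<in> Hom C A B2"
  \<comment> \<open>With the projections exchanged, \<open>f2\<close> is the pure component of a
    left pair; afterwards only the order of the conjuncts has to be restored.\<close>
  then have "\<exists>!h. h \<in> Hom (propagators C E) A (Prod C B1 B2) \<and>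
      dominates C E A B2 f2 (Comp (propagators C E) A (Prod C B1 B2) B2
        (pure_propagator C E (Prod C B1 B2) B2 (Pr2 C B1 B2)) h) \<and>
      Comp (propagators C E) A (Prod C B1 B2) B1
        (pure_propagator C E (Prod C B1 B2) B1 (Pr1 C B1 B2)) h = f1"
    using product_swap[OF product[of B1 B2]] by (intro left_pair_ex1) simp_all
  then show "\<exists>!h. h \<in> Hom (propagators C E) A (Prod C B1 B2) \<and>
      Comp (propagators C E) A (Prod C B1 B2) B1
        (pure_propagator C E (Prod C B1 B2) B1 (Pr1 C B1 B2)) h = f1 \<and>
      dominates C E A B2 f2 (Comp (propagators C E) A (Prod C B1 B2) B2
        (pure_propagator C E (Prod C B1 B2) B2 (Pr2 C B1 B2)) h)"
    by (metis (no_types, lifting))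
qed (simp add: dominates_pure_iff)

end

theorem theorem4p2:
  fixes C :: "('o, 'm) bicartesian" and E :: 'o
  assumes "is_bicartesian C"
    and "E \<in> Obj C"
    and "extensive_wrt C E"
  shows "language_with_effects C (propagators C E) (pure_propagator C E) \<and>
    compatible_with_conditionals C (propagators C E) (pure_propagator C E) \<and>
    compatible_with_sequential_pairs C (propagators C E) (pure_propagator C E) (dominates C E)"
proof -
  interpret extensive_exception_category C E
    using assms by unfold_locales
  show ?thesis
    using language propagators_conditionals sequential_pairs by blast
qed

end
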